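(* Let $T$ be a continuous t-norm and $\boldsymbol\Omega=(\omega_1,\dots,\omega_n)^\top$ a weight vector with $\omega_j\in(0,1]$ and $\sum_{j=1}^n\omega_j=1$. Then for $\gamma_j=\langle\mu_{\gamma_j},\nu_{\gamma_j}\rangle\in\tilde{\mathbb I}$ ($1\le j\le n$): (1) (Idempotency) If $\gamma_1=\gamma_2=\cdots=\gamma_n=\gamma$, then $\mathrm{IFWA}_{T,\boldsymbol\Omega}(\gamma_1,\dots,\gamma_n)=\mathrm{IFWG}_{T,\boldsymbol\Omega}(\gamma_1,\dots,\gamma_n)=\gamma$. (2) (Boundedness) $\gamma^-\le_{\mathrm{Xu}}\mathrm{IFWA}_{T,\boldsymbol\Omega}(\gamma_1,\dots,\gamma_n)\le_{\mathrm{Xu}}\gamma^+$ and $\gamma^-\le_{\mathrm{Xu}}\mathrm{IFWG}_{T,\boldsymbol\Omega}(\gamma_1,\dots,\gamma_n)\le_{\mathrm{Xu}}\gamma^+$, where $\gamma^-=\langle\min_{1\le j\le n}\mu_{\gamma_j},\max_{1\le j\le n}\nu_{\gamma_j}\rangle$ and $\gamma^+=\langle\max_{1\le j\le n}\mu_{\gamma_j},\min_{1\le j\le n}\nu_{\gamma_j}\rangle$. (3) (Monotonicity) If $\beta_j=\langle\mu_{\beta_j},\nu_{\beta_j}\rangle\in\tilde{\mathbb I}$ ($1\le j\le n$) satisfy $\mu_{\beta_j}\ge\mu_{\gamma_j}$ and $\nu_{\beta_j}\le\nu_{\gamma_j}$ for all $j$, then $\mathrm{IFWA}_{T,\boldsymbol\Omega}(\gamma_1,\dots,\gamma_n)\le_{\mathrm{Xu}}\mathrm{IFWA}_{T,\boldsymbol\Omega}(\beta_1,\dots,\beta_n)$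 and $\mathrm{IFWG}_{T,\boldsymbol\Omega}(\gamma_1,\dots,\gamma_n)\le_{\mathrm{Xu}}\mathrm{IFWG}_{T,\boldsymbol\Omega}(\beta_1,\dots,\beta_n)$.
   Context: A t-norm is a map $T:[0,1]^2\to[0,1]$ that is commutative, associative, nondecreasing in each argument, with $T(x,1)=x$; a t-conorm $S$ satisfies the same with $S(x,0)=x$ in place of $T(x,1)=x$. The dual t-conorm of $T$ is $S(x,y)=1-T(1-x,1-y)$. Powers: $\mathbb N=\{1,2,\dots\}$. $x_T^{(0)}=1$, $x_T^{(1)}=x$, $x_T^{(n)}=T(x_T^{(n-1)},x)$, and $x_S^{(0)}=0$, $x_S^{(1)}=x$, $x_S^{(n)}=S(x_S^{(n-1)},x)$. For $T,S$ continuous, $u\in[0,1]$, $p,q\in\mathbb N$: $u_T^{(1/p)}=\sup\{v\in[0,1]\mid v_T^{(p)}<u\}$ ($\sup\varnothing=0$), $u_S^{(1/p)}=\inf\{v\in[0,1]\mid v_S^{(p)}>u\}$ ($\inf\varnothing=1$), $u_T^{(q/p)}=(u_T^{(1/p)})_T^{(q)}$, $u_S^{(q/p)}=(u_S^{(1/p)})_S^{(q)}$ (independent of the representation of the fraction). For real $t>0$: $u_T^{(t)}=\inf\{u_T^{(r)}\mid r\in[0,t]\cap\mathbb Q\}$ and $u_S^{(t)}=\sup\{u_S^{(r)}\mid r\in[0,t]\cap\mathbb Q\}$ (these agree with the preceding definitions for rational $t>0$). Intuitionistic fuzzy values (IFVs): $\tilde{\mathbb I}=\{\langle\mu,\nu\rangle\in[0,1]^2\mid\mu+\nu\le1\}$.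 For a continuous t-norm $T$ with dual t-conorm $S$, $\alpha,\beta\in\tilde{\mathbb I}$, $\lambda>0$: $\alpha\oplus_T\beta=\langle S(\mu_\alpha,\mu_\beta),T(\nu_\alpha,\nu_\beta)\rangle$; $\alpha\otimes_T\beta=\langle T(\mu_\alpha,\mu_\beta),S(\nu_\alpha,\nu_\beta)\rangle$; $\lambda_T\alpha=\langle(\mu_\alpha)_S^{(\lambda)},(\nu_\alpha)_T^{(\lambda)}\rangle$; $\alpha^{\lambda_T}=\langle(\mu_\alpha)_T^{(\lambda)},(\nu_\alpha)_S^{(\lambda)}\rangle$; all of these lie in $\tilde{\mathbb I}$. Define $\mathrm{IFWA}_{T,\boldsymbol\Omega}(\gamma_1,\dots,\gamma_n)=((\omega_1)_T\gamma_1)\oplus_T\cdots\oplus_T((\omega_n)_T\gamma_n)$ and $\mathrm{IFWG}_{T,\boldsymbol\Omega}(\gamma_1,\dots,\gamma_n)=(\gamma_1^{(\omega_1)_T})\otimes_T\cdots\otimes_T(\gamma_n^{(\omega_n)_T})$. Order: for $\alpha\in\tilde{\mathbb I}$ let $S(\alpha)=\mu_\alpha-\nu_\alpha$ (score) and $A(\alpha)=\mu_\alpha+\nu_\alpha$ (accuracy). Then $\alpha<_{\mathrm{Xu}}\beta$ iff $S(\alpha)<S(\beta)$, or $S(\alpha)=S(\beta)$ and $A(\alpha)<A(\beta)$; $\alpha\le_{\mathrm{Xu}}\beta$ iff $\alpha<_{\mathrm{Xu}}\beta$ or $\alpha=\beta$. *)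

theory Defs
  imports "HOL-Analysis.Analysis"
begin

text \<open>
  Binary operations on the unit interval are total functions on the reals; only their values on
  \<open>[0,1] \<times> [0,1]\<close> matter.
\<close>

definition tnorm :: "(real \<Rightarrow> real \<Rightarrow> real) \<Rightarrow> bool" where
  "tnorm T \<longleftrightarrow>
     (\<forall>x\<in>{0..1}. \<forall>y\<in>{0..1}. T x y \<in> {0..1}) \<and>
     (\<forall>x\<in>{0..1}. \<forall>y\<in>{0..1}. T x y = T y x) \<and>
     (\<forall>x\<in>{0..1}. \<forall>y\<in>{0..1}. \<forall>z\<in>{0..1}. T (T x y) z = T x (T y z)) \<and>
     (\<forall>x\<in>{0..1}. \<forall>x'\<in>{0..1}. \<forall>y\<in>{0..1}. \<forall>y'\<in>{0..1}.
        x \<le> x' \<longrightarrow> y \<le> y' \<longrightarrow> T x y \<le> T x' y') \<and>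
     (\<forall>x\<in>{0..1}. T x 1 = x)"

definition continuous_tnorm :: "(real \<Rightarrow> real \<Rightarrow> real) \<Rightarrow> bool" where
  "continuous_tnorm T \<longleftrightarrow> tnorm T \<and> continuous_on ({0..1} \<times> {0..1}) (\<lambda>(x, y). T x y)"

definition dual_conorm :: "(real \<Rightarrow> real \<Rightarrow> real) \<Rightarrow> real \<Rightarrow> real \<Rightarrow> real" where
  "dual_conorm T x y = 1 - T (1 - x) (1 - y)"


fun tn_pow :: "(real \<Rightarrow> real \<Rightarrow> real) \<Rightarrow> real \<Rightarrow> nat \<Rightarrow> real" where
  "tn_pow T x 0 = 1"
| "tn_pow T x (Suc 0) = x"
| "tn_pow T x (Suc (Suc n)) = T (tn_pow T x (Suc n)) x"

fun tc_pow :: "(real \<Rightarrow> real \<Rightarrow> real) \<Rightarrow> real \<Rightarrow> nat \<Rightarrow> real" where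
  "tc_pow S x 0 = 0"
| "tc_pow S x (Suc 0) = x"
| "tc_pow S x (Suc (Suc n)) = S (tc_pow S x (Suc n)) x"

text \<open>
  The roots are a supremum and an infimum in \<open>[0,1]\<close>, so over the empty set they are 0 and 1;
  the supremum and infimum of the empty set of reals are not these values in the library.
\<close>

definition tn_root :: "(real \<Rightarrow> real \<Rightarrow> real) \<Rightarrow> nat \<Rightarrow> real \<Rightarrow> real" where
  "tn_root T p u =
     (let V = {v \<in> {0..1}. tn_pow T v p < u} in if V = {} then 0 else Sup V)"

definition tc_root :: "(real \<Rightarrow> real \<Rightarrow> real) \<Rightarrow> nat \<Rightarrow> real \<Rightarrow> real" where
  "tc_root S p u =
     (let V = {v \<in> {0..1}. tc_pow S v p > u} in if V = {} then 1 else Inf V)"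

definition tn_ratpow :: "(real \<Rightarrow> real \<Rightarrow> real) \<Rightarrow> real \<Rightarrow> nat \<Rightarrow> nat \<Rightarrow> real" where
  "tn_ratpow T u q p = tn_pow T (tn_root T p u) q"

definition tc_ratpow :: "(real \<Rightarrow> real \<Rightarrow> real) \<Rightarrow> real \<Rightarrow> nat \<Rightarrow> nat \<Rightarrow> real" where
  "tc_ratpow S u q p = tc_pow S (tc_root S p u) q"

text \<open>
  The rationals in \<open>[0,t]\<close> range over all fractions \<open>q/p\<close> with \<open>p \<ge> 1\<close>, not necessarily in lowest
  terms, so no choice of a representative is involved. The exponent 0 is included through
  \<open>q = 0\<close>, where the value is 1 (t-norm) or 0 (t-conorm).
\<close>

definition tn_realpow :: "(real \<Rightarrow> real \<Rightarrow> real) \<Rightarrow> real \<Rightarrow> real \<Rightarrow> real" where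
  "tn_realpow T u t = Inf {tn_ratpow T u q p | q p. p \<ge> 1 \<and> real q / real p \<le> t}"

definition tc_realpow :: "(real \<Rightarrow> real \<Rightarrow> real) \<Rightarrow> real \<Rightarrow> real \<Rightarrow> real" where
  "tc_realpow S u t = Sup {tc_ratpow S u q p | q p. p \<ge> 1 \<and> real q / real p \<le> t}"


text \<open>An intuitionistic fuzzy value is a pair (membership degree, non-membership degree).\<close>

type_synonym ifv = "real \<times> real"

definition IFV :: "ifv set" where
  "IFV = {(\<mu>, \<nu>). \<mu> \<in> {0..1} \<and> \<nu> \<in> {0..1} \<and> \<mu> + \<nu> \<le> 1}"

definition ifv_add :: "(real \<Rightarrow> real \<Rightarrow> real) \<Rightarrow> ifv \<Rightarrow> ifv \<Rightarrow> ifv" where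
  "ifv_add T \<alpha> \<beta> = (dual_conorm T (fst \<alpha>) (fst \<beta>), T (snd \<alpha>) (snd \<beta>))"

definition ifv_mult :: "(real \<Rightarrow> real \<Rightarrow> real) \<Rightarrow> ifv \<Rightarrow> ifv \<Rightarrow> ifv" where
  "ifv_mult T \<alpha> \<beta> = (T (fst \<alpha>) (fst \<beta>), dual_conorm T (snd \<alpha>) (snd \<beta>))"

definition ifv_scale :: "(real \<Rightarrow> real \<Rightarrow> real) \<Rightarrow> real \<Rightarrow> ifv \<Rightarrow> ifv" where
  "ifv_scale T l \<alpha> = (tc_realpow (dual_conorm T) (fst \<alpha>) l, tn_realpow T (snd \<alpha>) l)"

definition ifv_power :: "(real \<Rightarrow> real \<Rightarrow> real) \<Rightarrow> ifv \<Rightarrow> real \<Rightarrow> ifv" where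
  "ifv_power T \<alpha> l = (tn_realpow T (fst \<alpha>) l, tc_realpow (dual_conorm T) (snd \<alpha>) l)"

text \<open>Families are indexed by \<open>1, \<dots>, n\<close> with \<open>n \<ge> 1\<close>; iterated operations associate to the left.\<close>

definition iter_op :: "('a \<Rightarrow> 'a \<Rightarrow> 'a) \<Rightarrow> nat \<Rightarrow> (nat \<Rightarrow> 'a) \<Rightarrow> 'a" where
  "iter_op f n x = foldl f (x 1) (map x [2..<Suc n])"

definition IFWA ::
    "(real \<Rightarrow> real \<Rightarrow> real) \<Rightarrow> nat \<Rightarrow> (nat \<Rightarrow> real) \<Rightarrow> (nat \<Rightarrow> ifv) \<Rightarrow> ifv" where
  "IFWA T n \<omega> \<gamma> = iter_op (ifv_add T) n (\<lambda>j. ifv_scale T (\<omega> j) (\<gamma> j))"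

definition IFWG ::
    "(real \<Rightarrow> real \<Rightarrow> real) \<Rightarrow> nat \<Rightarrow> (nat \<Rightarrow> real) \<Rightarrow> (nat \<Rightarrow> ifv) \<Rightarrow> ifv" where
  "IFWG T n \<omega> \<gamma> = iter_op (ifv_mult T) n (\<lambda>j. ifv_power T (\<gamma> j) (\<omega> j))"


definition score :: "ifv \<Rightarrow> real" where
  "score \<alpha> = fst \<alpha> - snd \<alpha>"

definition accuracy :: "ifv \<Rightarrow> real" where
  "accuracy \<alpha> = fst \<alpha> + snd \<alpha>"

definition less_Xu :: "ifv \<Rightarrow> ifv \<Rightarrow> bool" where
  "less_Xu \<alpha> \<beta> \<longleftrightarrow>
     score \<alpha> < score \<beta> \<or> (score \<alpha> = score \<beta> \<and> accuracy \<alpha> < accuracy \<beta>)"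

definition le_Xu :: "ifv \<Rightarrow> ifv \<Rightarrow> bool" where
  "le_Xu \<alpha> \<beta> \<longleftrightarrow> less_Xu \<alpha> \<beta> \<or> \<alpha> = \<beta>"

definition ifv_lower :: "nat \<Rightarrow> (nat \<Rightarrow> ifv) \<Rightarrow> ifv" where
  "ifv_lower n \<gamma> = (Min ((\<lambda>j. fst (\<gamma> j)) ` {1..n}), Max ((\<lambda>j. snd (\<gamma> j)) ` {1..n}))"

definition ifv_upper :: "nat \<Rightarrow> (nat \<Rightarrow> ifv) \<Rightarrow> ifv" where
  "ifv_upper n \<gamma> = (Max ((\<lambda>j. fst (\<gamma> j)) ` {1..n}), Min ((\<lambda>j. snd (\<gamma> j)) ` {1..n}))"

end

theory Submission
  imports Defs
begin

text \<open>
  Everything happens one coordinate at a time. Since \<open>S\<close> is the dual of \<open>T\<close>, the reflection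
  \<open>x \<mapsto> 1 - x\<close> turns every power and aggregate formed with \<open>S\<close> into the one formed with \<open>T\<close>, so
  each coordinate of an aggregate is \<open>A(x)\<close> or \<open>1 - A(1 - x)\<close>, where \<open>A(x)\<close> is the \<open>T\<close>-product of
  the real powers \<open>x\<^sub>j\<^bsup>(\<omega>\<^sub>j)\<^esup>\<close> (\<open>tnorm_mean\<close> below). Two properties of \<open>A\<close> suffice: it is monotone
  in each \<open>x\<^sub>j\<close>, and it sends a constant family to the constant. Boundedness follows from the two by
  comparison with constant families, and the order of Xu extends the componentwise order.

  That \<open>A\<close> preserves constants is the exponent law \<open>u\<^bsup>(s+t)\<^esup> = T(u\<^bsup>(s)\<^esup>, u\<^bsup>(t)\<^esup>)\<close> for real
  exponents (\<open>realpow_add\<close>), together with \<open>u\<^bsup>(1)\<^esup> = u\<close>. For rational exponents the law rests on one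
  observation: the \<open>p\<close>-th root is the lower adjoint of the \<open>p\<close>-th power
  (\<open>root_le_iff\<close>), so roots compose like their exponents and a fraction may be expanded freely.
  For real exponents it needs left-continuity of \<open>r \<mapsto> u\<^bsup>(r)\<^esup>\<close> at rational points, because
  \<open>s + t\<close> may be rational while \<open>s\<close> and \<open>t\<close> are not. This holds since the
  supremum \<open>e\<close> of the roots of \<open>u\<close> is idempotent, and below an idempotent of a continuous t-norm
  \<open>T(\<cdot>, e)\<close> is the identity (\<open>idempotent_acts_as_unit\<close>): the factor
  \<open>u\<^bsup>(1/p)\<^esup>\<close> that separates \<open>u\<^bsup>(r)\<^esup>\<close> from \<open>u\<^bsup>(r - 1/p)\<^esup>\<close> has no effect in the limit
  (\<open>ratpow_left_continuous\<close>).
\<close>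

section \<open>Powers and roots for a continuous t-norm\<close>

locale cont_tnorm =
  fixes T :: "real \<Rightarrow> real \<Rightarrow> real"
  assumes cont: "continuous_tnorm T"
begin

lemma T_closed: "x \<in> {0..1} \<Longrightarrow> y \<in> {0..1} \<Longrightarrow> T x y \<in> {0..1}"
  and T_comm: "x \<in> {0..1} \<Longrightarrow> y \<in> {0..1} \<Longrightarrow> T x y = T y x"
  and T_assoc: "x \<in> {0..1} \<Longrightarrow> y \<in> {0..1} \<Longrightarrow> z \<in> {0..1} \<Longrightarrow> T (T x y) z = T x (T y z)"
  and T_mono: "x \<in> {0..1} \<Longrightarrow> x' \<in> {0..1} \<Longrightarrow> y \<in> {0..1} \<Longrightarrow> y' \<in> {0..1} \<Longrightarrow>
     x \<le> x' \<Longrightarrow> y \<le> y' \<Longrightarrow> T x y \<le> T x' y'"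
  and T_one: "x \<in> {0..1} \<Longrightarrow> T x 1 = x"
  using cont unfolding continuous_tnorm_def tnorm_def by blast+

lemma T_continuous: "continuous_on ({0..1} \<times> {0..1}) (\<lambda>(x, y). T x y)"
  using cont unfolding continuous_tnorm_def by blast

lemma T_one_left: "x \<in> {0..1} \<Longrightarrow> T 1 x = x"
  using T_comm[of 1 x] T_one[of x] by simp

lemma T_le_left: "x \<in> {0..1} \<Longrightarrow> y \<in> {0..1} \<Longrightarrow> T x y \<le> x"
  using T_mono[of x x y 1] T_one[of x] by auto

lemma T_zero_left: "x \<in> {0..1} \<Longrightarrow> T 0 x = 0"
  using T_le_left[of 0 x] T_closed[of 0 x] by auto

lemma T_compose_continuous:
  assumes "continuous_on X f" "continuous_on X g" "f ` X \<subseteq> {0..1}" "g ` X \<subseteq> {0..1}"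
  shows "continuous_on X (\<lambda>x. T (f x) (g x))"
proof -
  have "continuous_on X (\<lambda>x. (\<lambda>(x, y). T x y) (f x, g x))"
    by (rule continuous_on_compose2[OF T_continuous])
      (use assms in \<open>auto intro!: continuous_intros\<close>)
  then show ?thesis by simp
qed

text \<open>Continuity in the form used for suprema and infima: they are limits of elements.\<close>

lemma T_closure_mem:
  assumes "A \<subseteq> {0..1}" "B \<subseteq> {0..1}" "x \<in> closure A" "y \<in> closure B" "closed C"
    and TC: "\<And>a b. a \<in> A \<Longrightarrow> b \<in> B \<Longrightarrow> T a b \<in> C"
  shows "T x y \<in> C"
proof -
  let ?P = "({0..1} \<times> {0..1}) \<inter> (\<lambda>(x, y). T x y) -` C"
  have "closed ?P"
    by (intro continuous_closed_preimage T_continuous closed_Times \<open>closed C\<close>) auto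
  moreover have "A \<times> B \<subseteq> ?P"
    using assms by auto
  ultimately have "closure (A \<times> B) \<subseteq> ?P"
    by (rule closure_minimal[rotated])
  then show ?thesis
    using assms by (auto simp: closure_Times)
qed

lemma pow_Suc: "x \<in> {0..1} \<Longrightarrow> tn_pow T x (Suc n) = T (tn_pow T x n) x"
  by (cases n) (auto simp: T_one_left)

lemma pow_closed: "x \<in> {0..1} \<Longrightarrow> tn_pow T x n \<in> {0..1}"
proof (induction n)
  case (Suc n)
  then show ?case using T_closed by (simp add: pow_Suc del: tn_pow.simps(3))
qed simp

lemma pow_add:
  assumes x: "x \<in> {0..1}"
  shows "tn_pow T x (m + n) = T (tn_pow T x m) (tn_pow T x n)"
proof (induction n)
  case 0
  then show ?case using T_one[OF pow_closed[OF x]] by simp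
next
  case (Suc n)
  then show ?case
    using T_assoc[OF pow_closed[OF x] pow_closed[OF x] x] pow_Suc[OF x] by simp
qed

lemma pow_mult:
  assumes x: "x \<in> {0..1}"
  shows "tn_pow T x (m * n) = tn_pow T (tn_pow T x m) n"
proof (induction n)
  case (Suc n)
  have "tn_pow T x (m * Suc n) = T (tn_pow T x (m * n)) (tn_pow T x m)"
    using pow_add[OF x, of "m * n" m] by (simp add: add.commute)
  then show ?case
    using Suc pow_Suc[OF pow_closed[OF x]] by simp
qed simp

lemma pow_mono:
  assumes "x \<in> {0..1}" "y \<in> {0..1}" "x \<le> y"
  shows "tn_pow T x n \<le> tn_pow T y n"
proof (induction n)
  case (Suc n)
  then show ?case
    using T_mono[OF pow_closed pow_closed] pow_Suc assms by metis
qed simp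

lemma pow_antimono:
  assumes x: "x \<in> {0..1}" and "m \<le> n"
  shows "tn_pow T x n \<le> tn_pow T x m"
proof -
  have "tn_pow T x (m + (n - m)) \<le> tn_pow T x m"
    unfolding pow_add[OF x] by (intro T_le_left pow_closed x)
  then show ?thesis using \<open>m \<le> n\<close> by simp
qed

lemma pow_of_one: "tn_pow T 1 n = 1"
  by (induction n) (auto simp: pow_Suc T_one)

lemma pow_of_zero: "n \<ge> 1 \<Longrightarrow> tn_pow T 0 n = 0"
  using pow_antimono[of 0 1 n] pow_closed[of 0 n] by auto

lemma pow_continuous: "continuous_on {0..1} (\<lambda>x. tn_pow T x n)"
proof (induction n)
  case (Suc n)
  have "continuous_on {0..1} (\<lambda>x. T (tn_pow T x n) x)"
    by (rule T_compose_continuous[OF Suc])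
      (use pow_closed in \<open>auto intro!: continuous_intros simp del: atLeastAtMost_iff\<close>)
  then show ?case
    by (rule continuous_on_eq) (simp add: pow_Suc)
qed simp

text \<open>
  By continuity and monotonicity of the power the set \<open>{v. v\<^bsup>(p)\<^esup> \<ge> u}\<close> is an interval \<open>[m, 1]\<close>, so
  the defining supremum is taken over \<open>[0, m)\<close> and equals \<open>m\<close>. The convention for the empty set is
  exactly what makes this right when \<open>m = 0\<close>, that is, when \<open>u = 0\<close>.
\<close>

lemma root_characterization:
  assumes p: "p \<ge> 1" and u: "u \<in> {0..1}"
  shows "tn_root T p u \<in> {0..1}"
    and "\<And>v. v \<in> {0..1} \<Longrightarrow> tn_root T p u \<le> v \<longleftrightarrow> u \<le> tn_pow T v p"
    and "tn_pow T (tn_root T p u) p = u"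
proof -
  define W where "W = {v \<in> {0..1}. u \<le> tn_pow T v p}"
  have "closed ({0..1} \<inter> (\<lambda>v. tn_pow T v p) -` {u..})"
    by (intro continuous_closed_preimage pow_continuous) auto
  moreover have "{0..1} \<inter> (\<lambda>v. tn_pow T v p) -` {u..} = W"
    by (auto simp: W_def)
  ultimately have "closed W" by simp
  have "1 \<in> W" using u by (auto simp: W_def pow_of_one)
  have bdd: "bdd_below W" by (auto simp: W_def intro!: bdd_belowI[of _ 0])
  define m where "m = Inf W"
  have mW: "m \<in> W"
    unfolding m_def using closed_contains_Inf[of W] \<open>closed W\<close> \<open>1 \<in> W\<close> bdd by blast
  have mI: "m \<in> {0..1}" using mW by (simp add: W_def)
  have le_iff: "m \<le> v \<longleftrightarrow> u \<le> tn_pow T v p" if v: "v \<in> {0..1}" for v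
  proof
    assume "m \<le> v"
    then show "u \<le> tn_pow T v p"
      using pow_mono[OF mI v, of p] mW by (auto simp: W_def)
  next
    assume "u \<le> tn_pow T v p"
    then show "m \<le> v"
      unfolding m_def using v by (intro cInf_lower bdd) (simp add: W_def)
  qed
  have "tn_pow T v p < u \<longleftrightarrow> v < m" if "v \<in> {0..1}" for v
    using le_iff[OF that] by (simp add: not_le[symmetric])
  then have V: "{v \<in> {0..1}. tn_pow T v p < u} = {0..<m}"
    using mI by auto
  have root: "tn_root T p u = m"
    using mI unfolding tn_root_def V Let_def by auto
  obtain w where w: "w \<in> {0..1}" "tn_pow T w p = u"
    using IVT'[of "\<lambda>v. tn_pow T v p" 0 u 1] pow_continuous u p
    by (auto simp: pow_of_zero pow_of_one)
  have "tn_pow T m p \<le> u"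
    using pow_mono[OF mI w(1), of p] le_iff[OF w(1)] w(2) by simp
  moreover have "u \<le> tn_pow T m p" using mW by (simp add: W_def)
  ultimately show "tn_pow T (tn_root T p u) p = u" by (simp add: root)
  show "tn_root T p u \<in> {0..1}" using mI by (simp add: root)
  show "tn_root T p u \<le> v \<longleftrightarrow> u \<le> tn_pow T v p" if "v \<in> {0..1}" for v
    using le_iff[OF that] by (simp add: root)
qed

lemmas root_closed = root_characterization(1)
  and root_le_iff = root_characterization(2)
  and pow_root = root_characterization(3)

lemma root_mono:
  assumes "p \<ge> 1" "u \<in> {0..1}" "u' \<in> {0..1}" "u \<le> u'"
  shows "tn_root T p u \<le> tn_root T p u'"
  using assms by (simp add: root_le_iff root_closed pow_root del: atLeastAtMost_iff)

text \<open>Lower adjoints compose like the powers that they are adjoint to.\<close>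

lemma root_mult:
  assumes k: "k \<ge> 1" and p: "p \<ge> 1" and u: "u \<in> {0..1}"
  shows "tn_root T (k * p) u = tn_root T k (tn_root T p u)"
proof -
  have kp: "k * p \<ge> 1" using k p by simp
  have iff: "tn_root T (k * p) u \<le> v \<longleftrightarrow> tn_root T k (tn_root T p u) \<le> v" if v: "v \<in> {0..1}" for v
    using root_le_iff[OF kp u v] root_le_iff[OF k root_closed[OF p u] v]
      root_le_iff[OF p u pow_closed[OF v]] pow_mult[OF v, of k p] by simp
  show ?thesis
    using iff[OF root_closed[OF kp u]] iff[OF root_closed[OF k root_closed[OF p u]]]
    by simp
qed

lemma pow_root_mult:
  assumes "k \<ge> 1" "p \<ge> 1" "u \<in> {0..1}"
  shows "tn_pow T (tn_root T (k * p) u) k = tn_root T p u"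
  using assms by (simp add: root_mult pow_root root_closed del: atLeastAtMost_iff)

section \<open>Rational exponents\<close>

lemma ratpow_closed: "p \<ge> 1 \<Longrightarrow> u \<in> {0..1} \<Longrightarrow> tn_ratpow T u q p \<in> {0..1}"
  unfolding tn_ratpow_def by (intro pow_closed root_closed)

lemma ratpow_mono:
  assumes "p \<ge> 1" "u \<in> {0..1}" "u' \<in> {0..1}" "u \<le> u'"
  shows "tn_ratpow T u q p \<le> tn_ratpow T u' q p"
  unfolding tn_ratpow_def using assms by (intro pow_mono root_closed root_mono)

lemma ratpow_expand:
  assumes "k \<ge> 1" "p \<ge> 1" "u \<in> {0..1}"
  shows "tn_ratpow T u (k * q) (k * p) = tn_ratpow T u q p"
  using assms pow_root_mult[OF assms] root_closed[of "k * p" u]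
  by (simp add: tn_ratpow_def pow_mult del: atLeastAtMost_iff)

lemma ratpow_add:
  assumes "p \<ge> 1" "u \<in> {0..1}"
  shows "tn_ratpow T u (a + b) p = T (tn_ratpow T u a p) (tn_ratpow T u b p)"
  unfolding tn_ratpow_def using assms by (intro pow_add root_closed)

text \<open>
  Continuity makes every \<open>x \<le> e\<close> a product \<open>T(z, e)\<close>, and multiplying such a product by \<open>e\<close> again
  changes nothing.
\<close>

lemma idempotent_acts_as_unit:
  assumes e: "e \<in> {0..1}" "T e e = e" and x: "0 \<le> x" "x \<le> e"
  shows "T x e = x"
proof -
  have "continuous_on {0..1} (\<lambda>z. T z e)"
    by (rule T_compose_continuous) (use e in \<open>auto intro!: continuous_intros\<close>)
  then obtain z where z: "z \<in> {0..1}" "T z e = x"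
    using IVT'[of "\<lambda>z. T z e" 0 x 1] T_zero_left[of e] T_one_left[of e] e x by auto
  then show ?thesis
    using T_assoc[OF z(1) e(1) e(1)] e by simp
qed

text \<open>
  The supremum of a family of roots of \<open>u\<close> need not be \<open>1\<close>: if \<open>u\<close> is idempotent, all its roots
  are \<open>u\<close> itself. It is idempotent in any case, because the \<open>kp\<close>-th root is the
  square of the \<open>2kp\<close>-th.
\<close>

lemma Sup_roots_idempotent:
  assumes p: "p \<ge> 1" and u: "u \<in> {0..1}"
  defines "e \<equiv> SUP k\<in>{1..}. tn_root T (k * p) u"
  shows "e \<in> {0..1}" and "T e e = e"
    and "\<And>k. k \<ge> 1 \<Longrightarrow> tn_root T (k * p) u \<le> e"
    and "e \<in> closure ((\<lambda>k. tn_root T (k * p) u) ` {1..})"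
proof -
  let ?R = "(\<lambda>k. tn_root T (k * p) u) ` {1..}"
  have rI: "tn_root T (k * p) u \<in> {0..1}" if "k \<ge> 1" for k
    using that p u by (intro root_closed) auto
  have bdd: "bdd_above ?R"
    using rI by (intro bdd_aboveI[of _ 1]) auto
  show upper: "tn_root T (k * p) u \<le> e" if "k \<ge> 1" for k
    unfolding e_def using that by (intro cSup_upper bdd) auto
  have "e \<le> 1"
    unfolding e_def using rI by (intro cSup_least) auto
  moreover have "0 \<le> e"
    using rI[of 1] upper[of 1] by auto
  ultimately show eI: "e \<in> {0..1}" by simp
  show "e \<in> closure ?R"
    unfolding e_def by (intro closure_contains_Sup bdd) auto
  have "tn_root T (k * p) u \<le> T e e" if k: "k \<ge> 1" for k
  proof -
    let ?r = "tn_root T (2 * k * p) u"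
    have "tn_root T (k * p) u = tn_pow T ?r 2"
      using pow_root_mult[of 2 "k * p" u] k p u by (simp add: mult.assoc)
    also have "\<dots> = T ?r ?r"
      by (simp add: numeral_2_eq_2)
    also have "\<dots> \<le> T e e"
      using rI[of "2 * k"] upper[of "2 * k"] k eI by (intro T_mono) auto
    finally show ?thesis .
  qed
  then have "e \<le> T e e"
    unfolding e_def by (intro cSup_least) auto
  then show "T e e = e"
    using T_le_left[OF eI eI] by simp
qed

text \<open>
  Left-continuity of \<open>r \<mapsto> u\<^bsup>(r)\<^esup>\<close> at \<open>r = q/p\<close>: the approximating exponents are
  \<open>(kq - 1)/(kp) = r - 1/(kp)\<close>.
\<close>

lemma ratpow_left_continuous:
  assumes p: "p \<ge> 1" and q: "q \<ge> 1" and u: "u \<in> {0..1}" and M: "M \<in> {0..1}"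
    and le: "\<And>k. k \<ge> 1 \<Longrightarrow> M \<le> tn_ratpow T u (k * q - 1) (k * p)"
  shows "M \<le> tn_ratpow T u q p"
proof -
  let ?r = "\<lambda>k. tn_root T (k * p) u"
  define e where "e = (SUP k\<in>{1..}. ?r k)"
  note e = Sup_roots_idempotent[OF p u, folded e_def]
  have rI: "?r k \<in> {0..1}" if "k \<ge> 1" for k
    using that p u by (intro root_closed) auto
  have step: "T M (?r k) \<le> tn_ratpow T u q p" if k: "k \<ge> 1" for k
  proof -
    have "T M (?r k) \<le> T (tn_pow T (?r k) (k * q - 1)) (?r k)"
      using le[OF k] rI[OF k] M by (intro T_mono pow_closed) (auto simp: tn_ratpow_def)
    also have "\<dots> = tn_pow T (?r k) (k * q)"
      using pow_Suc[OF rI[OF k], of "k * q - 1"] k q by simp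
    also have "\<dots> = tn_ratpow T u q p"
      using ratpow_expand[OF k p u, of q] by (simp add: tn_ratpow_def)
    finally show ?thesis .
  qed
  have "T M e \<in> {..tn_ratpow T u q p}"
    by (rule T_closure_mem[of "{M}" "?r ` {1..}"]) (use step e(4) M rI in auto)
  moreover have "M \<le> e"
  proof -
    \<comment> \<open>for \<open>k = 2\<close> the exponent \<open>kq - 1\<close> is positive, so the power lies below the root\<close>
    have "M \<le> tn_pow T (?r 2) (2 * q - 1)"
      using le[of 2] by (simp add: tn_ratpow_def)
    also have "\<dots> \<le> tn_pow T (?r 2) 1"
      using q rI[of 2] by (intro pow_antimono) auto
    also have "\<dots> \<le> e" using e(3)[of 2] by simp
    finally show ?thesis .
  qed
  ultimately show ?thesis
    using idempotent_acts_as_unit[of e M] e M by auto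
qed

section \<open>Real exponents\<close>

abbreviation ratpows :: "real \<Rightarrow> real \<Rightarrow> real set" where
  "ratpows u t \<equiv> {tn_ratpow T u q p | q p. p \<ge> 1 \<and> real q / real p \<le> t}"

lemma ratpows_subset: "u \<in> {0..1} \<Longrightarrow> ratpows u t \<subseteq> {0..1}"
  using ratpow_closed by blast

lemma bdd_below_ratpows: "u \<in> {0..1} \<Longrightarrow> bdd_below (ratpows u t)"
  using ratpows_subset by (meson bdd_below_Icc bdd_below_mono)

lemma one_in_ratpows: "t \<ge> 0 \<Longrightarrow> 1 \<in> ratpows u t"
  by (rule CollectI, rule exI[of _ 0], rule exI[of _ 1]) (simp add: tn_ratpow_def)

lemma realpow_le_ratpow:
  "u \<in> {0..1} \<Longrightarrow> p \<ge> 1 \<Longrightarrow> real q / real p \<le> t \<Longrightarrow> tn_realpow T u t \<le> tn_ratpow T u q p"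
  unfolding tn_realpow_def by (intro cInf_lower bdd_below_ratpows) auto

lemma realpow_greatest:
  assumes "t \<ge> 0" "\<And>q p. p \<ge> 1 \<Longrightarrow> real q / real p \<le> t \<Longrightarrow> c \<le> tn_ratpow T u q p"
  shows "c \<le> tn_realpow T u t"
  unfolding tn_realpow_def using one_in_ratpows[OF assms(1)] assms(2)
  by (intro cInf_greatest) blast+

lemma realpow_closed:
  assumes u: "u \<in> {0..1}" and t: "t \<ge> 0"
  shows "tn_realpow T u t \<in> {0..1}"
proof -
  have "tn_realpow T u t \<le> 1"
    unfolding tn_realpow_def by (intro cInf_lower bdd_below_ratpows one_in_ratpows u t)
  moreover have "0 \<le> tn_realpow T u t"
    using ratpow_closed[OF _ u] by (intro realpow_greatest t) auto
  ultimately show ?thesis by simp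
qed

lemma realpow_mono:
  assumes "u \<in> {0..1}" "u' \<in> {0..1}" "u \<le> u'" "t \<ge> 0"
  shows "tn_realpow T u t \<le> tn_realpow T u' t"
proof (rule realpow_greatest[OF assms(4)])
  fix q p :: nat assume "p \<ge> 1" "real q / real p \<le> t"
  then show "tn_realpow T u t \<le> tn_ratpow T u' q p"
    using realpow_le_ratpow[OF assms(1)] ratpow_mono[OF _ assms(1-3)] by (meson order_trans)
qed

lemma realpow_one:
  assumes u: "u \<in> {0..1}"
  shows "tn_realpow T u 1 = u"
proof (rule antisym)
  have "tn_ratpow T u 1 1 = u"
    using pow_root[of 1 u] u by (simp add: tn_ratpow_def)
  then show "tn_realpow T u 1 \<le> u"
    using realpow_le_ratpow[OF u, of 1 1 1] by simp
next
  have "u \<le> tn_ratpow T u q p" if p: "p \<ge> 1" and "real q / real p \<le> 1" for q p :: nat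
  proof -
    have "q \<le> p" using that by (simp add: divide_simps)
    then show ?thesis
      using pow_antimono[OF root_closed[OF p u], of q p] pow_root[OF p u]
      by (simp add: tn_ratpow_def)
  qed
  then show "u \<le> tn_realpow T u 1" by (intro realpow_greatest) auto
qed

text \<open>
  For the inequality \<open>\<ge>\<close>, an exponent \<open>q/p \<le> s + t\<close> has to be approximated by sums of
  fractions below \<open>s\<close> and \<open>t\<close>. Rounding both \<open>s\<close> and \<open>t\<close> down to multiples of \<open>1/(kp)\<close> loses less
  than \<open>2/(kp)\<close> in total; as the outcome is a multiple of \<open>1/(kp)\<close>, it is at least \<open>q/p - 1/(kp)\<close>,
  and left-continuity removes this last defect as \<open>k\<close> varies.
\<close>

lemma realpow_add:
  assumes u: "u \<in> {0..1}" and s: "s \<ge> 0" and t: "t \<ge> 0"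
  shows "tn_realpow T u (s + t) = T (tn_realpow T u s) (tn_realpow T u t)"
proof (rule antisym)
  have sub: "T a b \<in> {tn_realpow T u (s + t)..}" if ab: "a \<in> ratpows u s" "b \<in> ratpows u t" for a b
  proof -
    obtain q p q' p' where a: "a = tn_ratpow T u q p" "p \<ge> 1" "real q / real p \<le> s"
      and b: "b = tn_ratpow T u q' p'" "p' \<ge> 1" "real q' / real p' \<le> t"
      using ab by blast
    have "T a b = T (tn_ratpow T u (p' * q) (p' * p)) (tn_ratpow T u (p * q') (p * p'))"
      using ratpow_expand[of p' p u q] ratpow_expand[of p p' u q'] a b u by simp
    also have "\<dots> = tn_ratpow T u (p' * q + p * q') (p * p')"
      using ratpow_add[of "p * p'" u] a b u by (simp add: mult.commute)
    also have "real (p' * q + p * q') / real (p * p') = real q / real p + real q' / real p'"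
      using a b by (simp add: field_simps)
    then have "tn_realpow T u (s + t) \<le> tn_ratpow T u (p' * q + p * q') (p * p')"
      using a b by (intro realpow_le_ratpow u) auto
    finally show ?thesis by simp
  qed
  have "T (tn_realpow T u s) (tn_realpow T u t) \<in> {tn_realpow T u (s + t)..}"
  proof (rule T_closure_mem[of "ratpows u s" "ratpows u t"])
    show "tn_realpow T u s \<in> closure (ratpows u s)" "tn_realpow T u t \<in> closure (ratpows u t)"
      unfolding tn_realpow_def using one_in_ratpows[OF s, of u] one_in_ratpows[OF t, of u]
      by (intro closure_contains_Inf bdd_below_ratpows u; blast)+
  qed (use sub ratpows_subset[OF u] in auto)
  then show "tn_realpow T u (s + t) \<le> T (tn_realpow T u s) (tn_realpow T u t)"
    by simp
next
  let ?M = "T (tn_realpow T u s) (tn_realpow T u t)"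
  have M: "?M \<in> {0..1}" by (intro T_closed realpow_closed u s t)
  have "?M \<le> tn_ratpow T u q p" if p: "p \<ge> 1" and le: "real q / real p \<le> s + t" for q p :: nat
  proof (cases "q = 0")
    case True
    then show ?thesis using M by (simp add: tn_ratpow_def)
  next
    case False
    then have q: "q \<ge> 1" by simp
    show ?thesis
    proof (rule ratpow_left_continuous[OF p q u M])
      fix k :: nat assume k: "k \<ge> 1"
      define P where "P = k * p"
      have P: "P \<ge> 1" using k p by (simp add: P_def)
      define a b where "a = nat \<lfloor>s * real P\<rfloor>" and "b = nat \<lfloor>t * real P\<rfloor>"
      have a: "real a \<le> s * real P" "s * real P < real a + 1"
        using s by (auto simp: a_def)
      have b: "real b \<le> t * real P" "t * real P < real b + 1"
        using t by (auto simp: b_def)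
      have "real (k * q) = real q / real p * real P"
        using p by (simp add: P_def)
      also have "\<dots> \<le> (s + t) * real P"
        using le by (intro mult_right_mono) auto
      also have "\<dots> < real (a + b + 2)"
        using a b by (simp add: distrib_right)
      finally have ab: "k * q - 1 \<le> a + b"
        by linarith
      have "?M \<le> T (tn_ratpow T u a P) (tn_ratpow T u b P)"
        using a b P by (intro T_mono realpow_closed ratpow_closed realpow_le_ratpow u s t)
          (auto simp: divide_simps)
      also have "\<dots> = tn_ratpow T u (a + b) P"
        using ratpow_add[OF P u] by simp
      also have "\<dots> \<le> tn_ratpow T u (k * q - 1) P"
        unfolding tn_ratpow_def by (intro pow_antimono root_closed P u ab)
      finally show "?M \<le> tn_ratpow T u (k * q - 1) (k * p)"
        by (simp add: P_def)
    qed
  qed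
  then show "?M \<le> tn_realpow T u (s + t)"
    using s t by (intro realpow_greatest) auto
qed

end

section \<open>Weighted means\<close>

lemma iter_op_1: "iter_op f (Suc 0) x = x 1"
  by (simp add: iter_op_def)

lemma iter_op_Suc: "n \<ge> 1 \<Longrightarrow> iter_op f (Suc n) x = f (iter_op f n x) (x (Suc n))"
  by (simp add: iter_op_def)

lemma iter_op_cong:
  assumes "n \<ge> 1" "\<And>j. j \<in> {1..n} \<Longrightarrow> x j = y j"
  shows "iter_op f n x = iter_op f n y"
  using assms by (induction n rule: nat_induct_at_least) (auto simp: iter_op_1 iter_op_Suc)

lemma iter_op_hom:
  assumes "n \<ge> 1" "\<And>a b. h (f a b) = g (h a) (h b)"
  shows "h (iter_op f n x) = iter_op g n (\<lambda>j. h (x j))"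
  using assms(1) by (induction n rule: nat_induct_at_least) (auto simp: iter_op_1 iter_op_Suc assms(2))

definition tnorm_mean ::
    "(real \<Rightarrow> real \<Rightarrow> real) \<Rightarrow> nat \<Rightarrow> (nat \<Rightarrow> real) \<Rightarrow> (nat \<Rightarrow> real) \<Rightarrow> real" where
  "tnorm_mean T n \<omega> x = iter_op T n (\<lambda>j. tn_realpow T (x j) (\<omega> j))"

context cont_tnorm
begin

lemma tnorm_mean_mono:
  assumes n: "n \<ge> 1" and "\<And>j. j \<in> {1..n} \<Longrightarrow> \<omega> j \<ge> 0"
    and "\<And>j. j \<in> {1..n} \<Longrightarrow> x j \<in> {0..1} \<and> y j \<in> {0..1} \<and> x j \<le> y j"
  shows "tnorm_mean T n \<omega> x \<in> {0..1} \<and> tnorm_mean T n \<omega> y \<in> {0..1} \<and>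
    tnorm_mean T n \<omega> x \<le> tnorm_mean T n \<omega> y"
  using assms
proof (induction n rule: nat_induct_at_least)
  case base
  then show ?case
    using realpow_closed[of "x 1" "\<omega> 1"] realpow_closed[of "y 1" "\<omega> 1"] realpow_mono[of "x 1" "y 1" "\<omega> 1"]
    by (simp add: tnorm_mean_def iter_op_1)
next
  case (Suc n)
  have IH: "tnorm_mean T n \<omega> x \<in> {0..1}" "tnorm_mean T n \<omega> y \<in> {0..1}"
      "tnorm_mean T n \<omega> x \<le> tnorm_mean T n \<omega> y"
    using Suc by auto
  have last: "\<omega> (Suc n) \<ge> 0" "x (Suc n) \<in> {0..1}" "y (Suc n) \<in> {0..1}" "x (Suc n) \<le> y (Suc n)"
    using Suc.prems(1)[of "Suc n"] Suc.prems(2)[of "Suc n"] by auto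
  have "tnorm_mean T (Suc n) \<omega> z = T (tnorm_mean T n \<omega> z) (tn_realpow T (z (Suc n)) (\<omega> (Suc n)))" for z
    using Suc.hyps by (simp add: tnorm_mean_def iter_op_Suc)
  then show ?case
    using IH last by (auto intro!: T_mono T_closed realpow_closed realpow_mono simp del: atLeastAtMost_iff)
qed

lemma tnorm_mean_const:
  assumes n: "n \<ge> 1" and w: "\<And>j. j \<in> {1..n} \<Longrightarrow> \<omega> j \<ge> 0" and u: "u \<in> {0..1}"
    and sum: "(\<Sum>j=1..n. \<omega> j) = 1"
  shows "tnorm_mean T n \<omega> (\<lambda>_. u) = u"
proof -
  have "tnorm_mean T n \<omega> (\<lambda>_. u) = tn_realpow T u (\<Sum>j=1..n. \<omega> j)"
    using n w
  proof (induction n rule: nat_induct_at_least)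
    case base
    then show ?case by (simp add: tnorm_mean_def iter_op_1)
  next
    case (Suc n)
    have IH: "tnorm_mean T n \<omega> (\<lambda>_. u) = tn_realpow T u (\<Sum>j=1..n. \<omega> j)"
      using Suc by auto
    have "0 \<le> (\<Sum>j=1..n. \<omega> j)" "0 \<le> \<omega> (Suc n)"
      using Suc.prems by (auto intro!: sum_nonneg)
    then show ?case
      using IH Suc.hyps realpow_add[OF u] by (simp add: tnorm_mean_def iter_op_Suc)
  qed
  then show ?thesis using sum realpow_one[OF u] by simp
qed

lemma tnorm_mean_bounds:
  assumes n: "n \<ge> 1" and w: "\<And>j. j \<in> {1..n} \<Longrightarrow> \<omega> j \<ge> 0" and sum: "(\<Sum>j=1..n. \<omega> j) = 1"
    and cd: "c \<in> {0..1}" "d \<in> {0..1}"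
    and x: "\<And>j. j \<in> {1..n} \<Longrightarrow> c \<le> x j \<and> x j \<le> d"
  shows "c \<le> tnorm_mean T n \<omega> x" "tnorm_mean T n \<omega> x \<le> d"
proof -
  have "x j \<in> {0..1}" if "j \<in> {1..n}" for j
    using x[OF that] cd by auto
  then show "c \<le> tnorm_mean T n \<omega> x" "tnorm_mean T n \<omega> x \<le> d"
    using tnorm_mean_mono[of n \<omega> "\<lambda>_. c" x] tnorm_mean_mono[of n \<omega> x "\<lambda>_. d"]
      tnorm_mean_const[OF n w _ sum] cd x n w by auto
qed

section \<open>Duality\<close>

lemma tc_pow_dual: "v \<in> {0..1} \<Longrightarrow> tc_pow (dual_conorm T) v n = 1 - tn_pow T (1 - v) n"
  by (induction "dual_conorm T" v n rule: tc_pow.induct) (auto simp: dual_conorm_def)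

lemma tc_root_dual: "tc_root (dual_conorm T) p u = 1 - tn_root T p (1 - u)"
proof -
  define V where "V = {v \<in> {0..1}. tn_pow T v p < 1 - u}"
  have refl: "{v \<in> {0..1}. tc_pow (dual_conorm T) v p > u} = (\<lambda>v. 1 - v) ` V"
  proof (intro set_eqI iffI)
    fix v assume "v \<in> {v \<in> {0..1}. tc_pow (dual_conorm T) v p > u}"
    then have "1 - v \<in> V" by (auto simp: V_def tc_pow_dual)
    then show "v \<in> (\<lambda>v. 1 - v) ` V" by (rule rev_image_eqI) simp
  qed (auto simp: V_def tc_pow_dual)
  have "Inf ((\<lambda>v. 1 - v) ` V) = 1 - Sup V" if "V \<noteq> {}"
  proof (rule cInf_eq_non_empty)
    have bdd: "bdd_above V" by (auto simp: V_def intro!: bdd_aboveI[of _ 1])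
    show "1 - Sup V \<le> x" if "x \<in> (\<lambda>v. 1 - v) ` V" for x
      using that cSup_upper[OF _ bdd] by auto
    show "y \<le> 1 - Sup V" if "\<And>x. x \<in> (\<lambda>v. 1 - v) ` V \<Longrightarrow> y \<le> x" for y
      using cSup_least[OF \<open>V \<noteq> {}\<close>, of "1 - y"] that by force
  qed (use that in auto)
  then show ?thesis
    unfolding tc_root_def tn_root_def refl V_def[symmetric] Let_def by auto
qed

lemma tc_realpow_dual:
  assumes u: "u \<in> {0..1}" and t: "t \<ge> 0"
  shows "tc_realpow (dual_conorm T) u t = 1 - tn_realpow T (1 - u) t"
proof -
  have u': "1 - u \<in> {0..1}" using u by auto
  have rat: "tc_ratpow (dual_conorm T) u q p = 1 - tn_ratpow T (1 - u) q p" if "p \<ge> 1" for q p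
    using root_closed[OF that u']
    by (simp add: tc_ratpow_def tn_ratpow_def tc_root_dual tc_pow_dual)
  have "{tc_ratpow (dual_conorm T) u q p | q p. p \<ge> 1 \<and> real q / real p \<le> t}
      = (\<lambda>x. 1 - x) ` ratpows (1 - u) t"
    using rat by (auto simp: image_iff) metis+
  moreover have "Sup ((\<lambda>x. 1 - x) ` ratpows (1 - u) t) = 1 - tn_realpow T (1 - u) t"
  proof (rule cSup_eq_non_empty)
    show "(\<lambda>x. 1 - x) ` ratpows (1 - u) t \<noteq> {}"
      using one_in_ratpows[OF t] by blast
    show "x \<le> 1 - tn_realpow T (1 - u) t" if "x \<in> (\<lambda>x. 1 - x) ` ratpows (1 - u) t" for x
      using that realpow_le_ratpow[OF u'] by fastforce
    show "1 - tn_realpow T (1 - u) t \<le> y"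
      if y: "\<And>x. x \<in> (\<lambda>x. 1 - x) ` ratpows (1 - u) t \<Longrightarrow> x \<le> y" for y
    proof -
      have "1 - y \<le> tn_ratpow T (1 - u) q p" if "p \<ge> 1" "real q / real p \<le> t" for q p
        using y[of "1 - tn_ratpow T (1 - u) q p"] that by fastforce
      then show ?thesis using realpow_greatest[OF t, of "1 - y"] by force
    qed
  qed
  ultimately show ?thesis by (simp add: tc_realpow_def)
qed

lemma conorm_mean_dual:
  assumes n: "n \<ge> 1" and w: "\<And>j. j \<in> {1..n} \<Longrightarrow> \<omega> j \<ge> 0"
    and x: "\<And>j. j \<in> {1..n} \<Longrightarrow> x j \<in> {0..1}"
  shows "iter_op (dual_conorm T) n (\<lambda>j. tc_realpow (dual_conorm T) (x j) (\<omega> j))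
    = 1 - tnorm_mean T n \<omega> (\<lambda>j. 1 - x j)"
proof -
  have "1 - tnorm_mean T n \<omega> (\<lambda>j. 1 - x j)
      = iter_op (dual_conorm T) n (\<lambda>j. 1 - tn_realpow T (1 - x j) (\<omega> j))"
    unfolding tnorm_mean_def using n
    by (rule iter_op_hom[where h = "\<lambda>v. 1 - v"]) (simp add: dual_conorm_def)
  also have "\<dots> = iter_op (dual_conorm T) n (\<lambda>j. tc_realpow (dual_conorm T) (x j) (\<omega> j))"
    using w x by (intro iter_op_cong n) (simp add: tc_realpow_dual)
  finally show ?thesis ..
qed

lemma IFWA_eq:
  assumes n: "n \<ge> 1" and w: "\<And>j. j \<in> {1..n} \<Longrightarrow> \<omega> j \<ge> 0"
    and g: "\<And>j. j \<in> {1..n} \<Longrightarrow> fst (\<gamma> j) \<in> {0..1}"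
  shows "IFWA T n \<omega> \<gamma> = (1 - tnorm_mean T n \<omega> (\<lambda>j. 1 - fst (\<gamma> j)), tnorm_mean T n \<omega> (\<lambda>j. snd (\<gamma> j)))"
  using conorm_mean_dual[of n \<omega> "\<lambda>j. fst (\<gamma> j)"]
    iter_op_hom[of n fst "ifv_add T" "dual_conorm T"] iter_op_hom[of n snd "ifv_add T" T] assms
  by (intro prod_eqI) (auto simp: IFWA_def tnorm_mean_def ifv_add_def ifv_scale_def)

lemma IFWG_eq:
  assumes n: "n \<ge> 1" and w: "\<And>j. j \<in> {1..n} \<Longrightarrow> \<omega> j \<ge> 0"
    and g: "\<And>j. j \<in> {1..n} \<Longrightarrow> snd (\<gamma> j) \<in> {0..1}"
  shows "IFWG T n \<omega> \<gamma> = (tnorm_mean T n \<omega> (\<lambda>j. fst (\<gamma> j)), 1 - tnorm_mean T n \<omega> (\<lambda>j. 1 - snd (\<gamma> j)))"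
  using conorm_mean_dual[of n \<omega> "\<lambda>j. snd (\<gamma> j)"]
    iter_op_hom[of n snd "ifv_mult T" "dual_conorm T"] iter_op_hom[of n fst "ifv_mult T" T] assms
  by (intro prod_eqI) (auto simp: IFWG_def tnorm_mean_def ifv_mult_def ifv_power_def)

end

section \<open>Aggregation of intuitionistic fuzzy values\<close>

text \<open>
  Raising the membership degree and lowering the non-membership degree both raise the score, so equal
  scores force both degrees to be unchanged, and the accuracy never decides.
\<close>

lemma le_Xu_componentwise:
  assumes "fst \<alpha> \<le> fst \<beta>" "snd \<beta> \<le> snd \<alpha>"
  shows "le_Xu \<alpha> \<beta>"
  using assms by (auto simp: le_Xu_def less_Xu_def score_def prod_eq_iff)

theorem proposition8:
  fixes T :: "real \<Rightarrow> real \<Rightarrow> real"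
    and n :: nat
    and \<omega> :: "nat \<Rightarrow> real"
    and \<gamma> :: "nat \<Rightarrow> ifv"
  assumes "continuous_tnorm T"
    and "\<forall>j\<in>{1..n}. \<omega> j \<in> {0<..1}"
    and "(\<Sum>j=1..n. \<omega> j) = 1"
    and "\<forall>j\<in>{1..n}. \<gamma> j \<in> IFV"
  shows
    "(\<forall>g. (\<forall>j\<in>{1..n}. \<gamma> j = g) \<longrightarrow> IFWA T n \<omega> \<gamma> = g \<and> IFWG T n \<omega> \<gamma> = g) \<and>
     (le_Xu (ifv_lower n \<gamma>) (IFWA T n \<omega> \<gamma>) \<and> le_Xu (IFWA T n \<omega> \<gamma>) (ifv_upper n \<gamma>) \<and>
      le_Xu (ifv_lower n \<gamma>) (IFWG T n \<omega> \<gamma>) \<and> le_Xu (IFWG T n \<omega> \<gamma>) (ifv_upper n \<gamma>)) \<and>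
     (\<forall>\<beta>. (\<forall>j\<in>{1..n}. \<beta> j \<in> IFV \<and> fst (\<beta> j) \<ge> fst (\<gamma> j) \<and> snd (\<beta> j) \<le> snd (\<gamma> j)) \<longrightarrow>
        le_Xu (IFWA T n \<omega> \<gamma>) (IFWA T n \<omega> \<beta>) \<and> le_Xu (IFWG T n \<omega> \<gamma>) (IFWG T n \<omega> \<beta>))"
proof -
  interpret cont_tnorm T by unfold_locales fact
  have n: "n \<ge> 1"
    using assms(3) by (cases n) auto
  have w: "\<omega> j \<ge> 0" if "j \<in> {1..n}" for j
    using assms(2) that by fastforce
  have IFV_I: "fst \<alpha> \<in> {0..1}" "snd \<alpha> \<in> {0..1}" if "\<alpha> \<in> IFV" for \<alpha>
    using that by (auto simp: IFV_def)
  have g: "fst (\<gamma> j) \<in> {0..1}" "snd (\<gamma> j) \<in> {0..1}" if "j \<in> {1..n}" for j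
    using assms(4) that IFV_I by blast+
  note bounds = tnorm_mean_bounds[where \<omega> = \<omega>, OF n w assms(3)]

  let ?A = "tnorm_mean T n \<omega>"
  have IFWA: "IFWA T n \<omega> \<delta> = (1 - ?A (\<lambda>j. 1 - fst (\<delta> j)), ?A (\<lambda>j. snd (\<delta> j)))"
    if "\<And>j. j \<in> {1..n} \<Longrightarrow> fst (\<delta> j) \<in> {0..1}" for \<delta>
    using n w that by (rule IFWA_eq)
  have IFWG: "IFWG T n \<omega> \<delta> = (?A (\<lambda>j. fst (\<delta> j)), 1 - ?A (\<lambda>j. 1 - snd (\<delta> j)))"
    if "\<And>j. j \<in> {1..n} \<Longrightarrow> snd (\<delta> j) \<in> {0..1}" for \<delta>
    using n w that by (rule IFWG_eq)
  have range: "c \<le> ?A x \<and> ?A x \<le> d \<and> c \<le> 1 - ?A (\<lambda>j. 1 - x j) \<and> 1 - ?A (\<lambda>j. 1 - x j) \<le> d"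
    if "c \<in> {0..1}" "d \<in> {0..1}" "\<And>j. j \<in> {1..n} \<Longrightarrow> c \<le> x j \<and> x j \<le> d" for c d x
    using bounds[of c d x] bounds[of "1 - d" "1 - c" "\<lambda>j. 1 - x j"] that by fastforce

  have idem: "IFWA T n \<omega> \<gamma> = h \<and> IFWG T n \<omega> \<gamma> = h" if h: "\<forall>j\<in>{1..n}. \<gamma> j = h" for h
  proof -
    have "fst h \<in> {0..1}" "snd h \<in> {0..1}"
      using g[of 1] h n by auto
    then show ?thesis
      using range[of "fst h" "fst h" "\<lambda>j. fst (\<gamma> j)"] range[of "snd h" "snd h" "\<lambda>j. snd (\<gamma> j)"]
        h IFWA[of \<gamma>] IFWG[of \<gamma>] g by (auto simp: prod_eq_iff)
  qed

  have minmax: "Min (x ` {1..n}) \<le> ?A x \<and> ?A x \<le> Max (x ` {1..n}) \<and>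
      Min (x ` {1..n}) \<le> 1 - ?A (\<lambda>j. 1 - x j) \<and> 1 - ?A (\<lambda>j. 1 - x j) \<le> Max (x ` {1..n})"
    if x: "\<And>j. j \<in> {1..n} \<Longrightarrow> x j \<in> {0..1}" for x
  proof (rule range)
    have "x ` {1..n} \<noteq> {}" using n by auto
    then have "Min (x ` {1..n}) \<in> x ` {1..n}" "Max (x ` {1..n}) \<in> x ` {1..n}"
      by (simp_all add: Min_in Max_in)
    moreover have "x ` {1..n} \<subseteq> {0..1}" using x by blast
    ultimately show "Min (x ` {1..n}) \<in> {0..1}" "Max (x ` {1..n}) \<in> {0..1}"
      by (simp_all only: subset_iff)
  qed auto
  have IFWA_\<gamma>: "IFWA T n \<omega> \<gamma> = (1 - ?A (\<lambda>j. 1 - fst (\<gamma> j)), ?A (\<lambda>j. snd (\<gamma> j)))"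
    using g(1) by (rule IFWA)
  have IFWG_\<gamma>: "IFWG T n \<omega> \<gamma> = (?A (\<lambda>j. fst (\<gamma> j)), 1 - ?A (\<lambda>j. 1 - snd (\<gamma> j)))"
    using g(2) by (rule IFWG)
  have bdd: "le_Xu (ifv_lower n \<gamma>) (IFWA T n \<omega> \<gamma>)" "le_Xu (IFWA T n \<omega> \<gamma>) (ifv_upper n \<gamma>)"
      "le_Xu (ifv_lower n \<gamma>) (IFWG T n \<omega> \<gamma>)" "le_Xu (IFWG T n \<omega> \<gamma>) (ifv_upper n \<gamma>)"
    unfolding IFWA_\<gamma> IFWG_\<gamma> ifv_lower_def ifv_upper_def
    using minmax[of "\<lambda>j. fst (\<gamma> j)", OF g(1)] minmax[of "\<lambda>j. snd (\<gamma> j)", OF g(2)]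
    by (simp_all add: le_Xu_componentwise)

  have mono: "le_Xu (IFWA T n \<omega> \<gamma>) (IFWA T n \<omega> \<beta>) \<and> le_Xu (IFWG T n \<omega> \<gamma>) (IFWG T n \<omega> \<beta>)"
    if dom: "\<forall>j\<in>{1..n}. \<beta> j \<in> IFV \<and> fst (\<beta> j) \<ge> fst (\<gamma> j) \<and> snd (\<beta> j) \<le> snd (\<gamma> j)" for \<beta>
  proof -
    have b: "fst (\<beta> j) \<in> {0..1}" "snd (\<beta> j) \<in> {0..1}" "fst (\<gamma> j) \<le> fst (\<beta> j)" "snd (\<beta> j) \<le> snd (\<gamma> j)"
      if "j \<in> {1..n}" for j
      using dom that IFV_I by blast+
    have le: "?A x \<le> ?A y \<and> ?A (\<lambda>j. 1 - y j) \<le> ?A (\<lambda>j. 1 - x j)"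
      if "\<And>j. j \<in> {1..n} \<Longrightarrow> x j \<in> {0..1} \<and> y j \<in> {0..1} \<and> x j \<le> y j" for x y
      using tnorm_mean_mono[of n \<omega> x y, OF n w that]
        tnorm_mean_mono[of n \<omega> "\<lambda>j. 1 - y j" "\<lambda>j. 1 - x j", OF n w] that by force
    have "?A (\<lambda>j. fst (\<gamma> j)) \<le> ?A (\<lambda>j. fst (\<beta> j)) \<and>
        ?A (\<lambda>j. 1 - fst (\<beta> j)) \<le> ?A (\<lambda>j. 1 - fst (\<gamma> j))"
      using b g by (intro le) blast
    moreover have "?A (\<lambda>j. snd (\<beta> j)) \<le> ?A (\<lambda>j. snd (\<gamma> j)) \<and>
        ?A (\<lambda>j. 1 - snd (\<gamma> j)) \<le> ?A (\<lambda>j. 1 - snd (\<beta> j))"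
      using b g by (intro le) blast
    moreover have "IFWA T n \<omega> \<beta> = (1 - ?A (\<lambda>j. 1 - fst (\<beta> j)), ?A (\<lambda>j. snd (\<beta> j)))"
      using b(1) by (rule IFWA)
    moreover have "IFWG T n \<omega> \<beta> = (?A (\<lambda>j. fst (\<beta> j)), 1 - ?A (\<lambda>j. 1 - snd (\<beta> j)))"
      using b(2) by (rule IFWG)
    ultimately show ?thesis
      by (simp add: IFWA_\<gamma> IFWG_\<gamma> le_Xu_componentwise)
  qed

  show ?thesis using idem bdd mono by blast
qed

end
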